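(* Let $n$ be a positive integer and let $\mathfrak{I}$ be the collection of all ordered $n$-sets $\mathcal{I}=\{I_r\}_{r=1}^n$ of $(1,1)$- or $(2,1)$-intervals of $\mathbb{R}^2$. Let $V:\mathfrak{I}\to\mathbb{R}^{6n}$ be the function $\mathcal{I}\mapsto \mathbb{v}_{\mathcal{I}}:=(\mathbf{v}_{I_1}|\cdots|\mathbf{v}_{I_n})$ (the concatenation of the vectors $\mathbf{v}_{I_r}\in\mathbb{R}^6$ for all $I_r\in\mathcal{I}$). Then the image of $\mathfrak{I}$ via the function $V$ is a convex subset of $\mathbb{R}^{6n}$.
   Context: $\mathbb{R}^2$ carries the product partial order. An interval of $\mathbb{R}^2$ is a nonempty subset $I$ such that $p,q\in I$ and $p\le r\le q$ imply $r\in I$, and which is connected (any two elements of $I$ are joined by a finite sequence of elements of $I$ whose consecutive terms are comparable). For positive integers $p,q$, a $(p,q)$-interval is an interval of $\mathbb{R}^2$ with exactly $p$ minimal points and exactly $q$ maximal points. The embedding $I\mapsto\mathbf{v}_I=(x,y,a,b,c,d)\in\mathbb{R}^6$ of $(1,1)$- and $(2,1)$-intervals: a $(2,1)$-interval $I$ with minimal points $(\xi_1,\eta_1),(\xi_2,\eta_2)$, where $\xi_1<\xi_2$ and $\eta_1>\eta_2$, and maximal point $(X,Y)$ has $\mathbf{v}_I=(\xi_2,\ \eta_1,\ Y-\eta_1,\ \xi_2-\xi_1,\ \eta_1-\eta_2,\ X-\xi_2)$; thus its minimal points are $(x-b,y)$ and $(x,y-c)$ and its maximal point is $(x+d,y+a)$.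 A $(1,1)$-interval with minimal point $(\xi,\eta)$ and maximal point $(X,Y)$ is represented in the same way with $b=c=0$, i.e. $\mathbf{v}_I=(\xi,\eta,Y-\eta,0,0,X-\xi)$.
   Formalization: A (p,q)-interval is also required to have each of its points above some minimal point and below some maximal point; without this the claim fails already for n = 1. Ordered n-sets are n-tuples, repetitions allowed. *)

theory Defs
  imports "HOL-Analysis.Analysis"
begin

definition minimal_points :: "'a::order set \<Rightarrow> 'a set" where
  "minimal_points I = {m \<in> I. \<forall>p\<in>I. p \<le> m \<longrightarrow> p = m}"

definition maximal_points :: "'a::order set \<Rightarrow> 'a set" where
  "maximal_points I = {m \<in> I. \<forall>p\<in>I. m \<le> p \<longrightarrow> p = m}"

definition poset_interval :: "'a::order set \<Rightarrow> bool" where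
  "poset_interval I \<longleftrightarrow>
     I \<noteq> {} \<and>
     (\<forall>p\<in>I. \<forall>q\<in>I. \<forall>r. p \<le> r \<and> r \<le> q \<longrightarrow> r \<in> I) \<and>
     (\<forall>p\<in>I. \<forall>q\<in>I. (\<lambda>u v. u \<in> I \<and> v \<in> I \<and> (u \<le> v \<or> v \<le> u))\<^sup>*\<^sup>* p q)"

text \<open>
  The plane is \<open>real \<times> real\<close> with its componentwise order. The last conjunct of \<open>pq_interval\<close> says that the
  interval is delimited by its minimal and maximal points. It is what makes an interval
  recoverable from these points (so that \<open>interval_vec\<close> below is an embedding); counting
  extremal points alone does not imply it. For instance the open strip \<open>-1 < 10 * s + t < 1\<close>
  together with the points \<open>(0, -1)\<close> and \<open>(1, -9)\<close> is an interval whose only minimal point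
  \<open>(0, -1)\<close> is not below its only maximal point \<open>(1, -9)\<close>.
\<close>

definition pq_interval :: "nat \<Rightarrow> nat \<Rightarrow> (real \<times> real) set \<Rightarrow> bool" where
  "pq_interval p q I \<longleftrightarrow>
     0 < p \<and> 0 < q \<and> poset_interval I \<and>
     card (minimal_points I) = p \<and> card (maximal_points I) = q \<and>
     (\<forall>z\<in>I. (\<exists>m\<in>minimal_points I. m \<le> z) \<and> (\<exists>M\<in>maximal_points I. z \<le> M))"

definition represents :: "(real \<times> real) set \<Rightarrow> real ^ 6 \<Rightarrow> bool" where
  "represents I v \<longleftrightarrow>
     (\<exists>\<xi> \<eta> X Y. minimal_points I = {(\<xi>, \<eta>)} \<and> maximal_points I = {(X, Y)} \<and>
        v = vector [\<xi>, \<eta>, Y - \<eta>, 0, 0, X - \<xi>]) \<or>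
     (\<exists>\<xi>1 \<eta>1 \<xi>2 \<eta>2 X Y. minimal_points I = {(\<xi>1, \<eta>1), (\<xi>2, \<eta>2)} \<and> \<xi>1 < \<xi>2 \<and> \<eta>1 > \<eta>2 \<and>
        maximal_points I = {(X, Y)} \<and>
        v = vector [\<xi>2, \<eta>1, Y - \<eta>1, \<xi>2 - \<xi>1, \<eta>1 - \<eta>2, X - \<xi>2])"

definition interval_vec :: "(real \<times> real) set \<Rightarrow> real ^ 6" where
  "interval_vec I = (THE v. represents I v)"

lemma represents_unique:
  assumes "represents I v" "represents I w"
  shows "v = w"
  using assms unfolding represents_def
  by (auto simp: doubleton_eq_iff)

lemma represents_exists:
  assumes "pq_interval 1 1 I \<or> pq_interval 2 1 I"
  shows "\<exists>v. represents I v"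
  using assms
proof
  assume "pq_interval 1 1 I"
  then show ?thesis
    by (auto simp: pq_interval_def represents_def card_1_singleton_iff)
next
  assume *: "pq_interval 2 1 I"
  then obtain m1 m2 M where "minimal_points I = {m1, m2}" "m1 \<noteq> m2"
      "maximal_points I = {M}"
    unfolding pq_interval_def card_1_singleton_iff card_2_iff One_nat_def by blast
  then obtain x1 y1 x2 y2 X Y where m: "minimal_points I = {(x1, y1), (x2, y2)}"
      "(x1, y1) \<noteq> (x2, y2)" and M: "maximal_points I = {(X, Y)}"
    by (cases m1, cases m2, cases M) blast
  have "(x1, y1) \<in> minimal_points I" "(x2, y2) \<in> minimal_points I"
    using m by auto
  then have "\<not> (x1, y1) \<le> (x2, y2)" "\<not> (x2, y2) \<le> (x1, y1)"
    using m(2) unfolding minimal_points_def by blast+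
  then consider "x1 < x2" "y1 > y2" | "x2 < x1" "y2 > y1"
    by fastforce
  then show ?thesis
  proof cases
    case 1
    then show ?thesis using m M unfolding represents_def by blast
  next
    case 2
    have "minimal_points I = {(x2, y2), (x1, y1)}" using m by blast
    then show ?thesis using 2 M unfolding represents_def by blast
  qed
qed

lemma interval_vec_eqI: "represents I v \<Longrightarrow> interval_vec I = v"
  unfolding interval_vec_def using represents_unique by blast

lemma represents_interval_vec:
  assumes "pq_interval 1 1 I \<or> pq_interval 2 1 I"
  shows "represents I (interval_vec I)"
  using represents_exists[OF assms] interval_vec_eqI by blast

text \<open>
  \<open>'n\<close> is the index set of the ordered collections, \<open>n = CARD('n)\<close>; entries may repeat.
  \<open>\<real>\<^sup>6\<^sup>n\<close> is \<open>real ^ ('n \<times> 6)\<close>, with coordinate \<open>(r, k)\<close> the \<open>k\<close>-th coordinate of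
  the \<open>r\<close>-th block; in the type \<open>6\<close>, the numerals \<open>1, \<dots>, 6\<close> denote its six distinct elements.
\<close>

definition interval_families :: "('n::finite \<Rightarrow> (real \<times> real) set) set" where
  "interval_families = {\<I>. \<forall>r. pq_interval 1 1 (\<I> r) \<or> pq_interval 2 1 (\<I> r)}"

definition family_vec :: "('n::finite \<Rightarrow> (real \<times> real) set) \<Rightarrow> real ^ ('n \<times> 6)" where
  "family_vec \<I> = (\<chi> i. interval_vec (\<I> (fst i)) $ snd i)"

end

theory Submission
  imports Defs
begin

text \<open>
  The image is a product, with one factor for each index, of copies of one set
  \<open>interval_vectors\<close> in \<open>\<real>\<^sup>6\<close>: the vectors \<open>(x, y, a, b, c, d)\<close> with \<open>a, d \<ge> 0\<close> and either
  \<open>b = c = 0\<close> or \<open>b, c > 0\<close> (lemma \<open>family_vec_image\<close>).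

  That \<open>a\<close> and \<open>d\<close> are nonnegative says that the minimal points lie below the maximal one; the
  alternative on \<open>(b, c)\<close> says whether there are one or two minimal points. Conversely, every vector
  of the set is attained, by the union of the order intervals \<open>[m, M]\<close> from the one or two prescribed
  minimal points \<open>m\<close> to the prescribed maximal point \<open>M\<close> (lemma \<open>interval_vec_image\<close>). This
  union is connected because all its elements are comparable with \<open>M\<close>.

  Although the two alternatives are disjoint and the second is not closed, their union is convex: the
  pairs \<open>(b, c)\<close> range over the open quadrant together with its apex, and a point strictly between
  the apex and a point of the quadrant lies in the quadrant (lemma \<open>convex_interval_vectors\<close>).
\<close>

section \<open>Intervals generated by an antichain and a top element\<close>

definition antichain_hull :: "'a::order set \<Rightarrow> 'a \<Rightarrow> 'a set" where
  "antichain_hull A M = (\<Union>m\<in>A. {m..M})"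

context
  fixes A :: "'a::order set" and M :: 'a
  assumes A_nonempty: "A \<noteq> {}"
    and A_below: "\<And>m. m \<in> A \<Longrightarrow> m \<le> M"
    and A_antichain: "\<And>m m'. m \<in> A \<Longrightarrow> m' \<in> A \<Longrightarrow> m \<le> m' \<Longrightarrow> m = m'"
begin

lemma minimal_points_antichain_hull: "minimal_points (antichain_hull A M) = A"
proof
  show "minimal_points (antichain_hull A M) \<subseteq> A"
  proof
    fix z assume z: "z \<in> minimal_points (antichain_hull A M)"
    then obtain m where m: "m \<in> A" "m \<le> z"
      by (auto simp: minimal_points_def antichain_hull_def)
    moreover have "m \<in> antichain_hull A M"
      using m A_below by (auto simp: antichain_hull_def)
    ultimately have "m = z"
      using z by (auto simp: minimal_points_def)
    then show "z \<in> A" using m by simp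
  qed
  show "A \<subseteq> minimal_points (antichain_hull A M)"
  proof
    fix m assume m: "m \<in> A"
    have "p = m" if p: "p \<in> antichain_hull A M" "p \<le> m" for p
    proof -
      obtain m' where m': "m' \<in> A" "m' \<le> p"
        using p by (auto simp: antichain_hull_def)
      then have "m' = m"
        using A_antichain m p order_trans by blast
      then show ?thesis using m' p by simp
    qed
    moreover have "m \<in> antichain_hull A M"
      using m A_below by (auto simp: antichain_hull_def)
    ultimately show "m \<in> minimal_points (antichain_hull A M)"
      by (simp add: minimal_points_def)
  qed
qed

lemma maximal_points_antichain_hull: "maximal_points (antichain_hull A M) = {M}"
proof -
  have "M \<in> antichain_hull A M"
    using A_nonempty A_below by (auto simp: antichain_hull_def)
  moreover have "z \<le> M" if "z \<in> antichain_hull A M" for z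
    using that by (auto simp: antichain_hull_def)
  ultimately show ?thesis
    unfolding maximal_points_def by (auto intro: antisym)
qed

lemma poset_interval_antichain_hull: "poset_interval (antichain_hull A M)"
proof -
  let ?I = "antichain_hull A M"
  let ?R = "\<lambda>u v. u \<in> ?I \<and> v \<in> ?I \<and> (u \<le> v \<or> v \<le> u)"
  have M: "M \<in> ?I"
    using A_nonempty A_below by (auto simp: antichain_hull_def)
  have below: "z \<le> M" if "z \<in> ?I" for z
    using that by (auto simp: antichain_hull_def)
  have "r \<in> ?I" if "p \<in> ?I" "q \<in> ?I" "p \<le> r" "r \<le> q" for p q r
    using that unfolding antichain_hull_def atLeastAtMost_iff UN_iff by (meson order_trans)
  moreover have "?R\<^sup>*\<^sup>* p q" if "p \<in> ?I" "q \<in> ?I" for p q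
  proof -
    have up: "?R p M" and down: "?R M q"
      using that M below by auto
    show ?thesis
      by (rule rtranclp_trans[OF r_into_rtranclp[of ?R, OF up] r_into_rtranclp[of ?R, OF down]])
  qed
  ultimately show ?thesis
    using M unfolding poset_interval_def by blast
qed

end

lemma pq_interval_antichain_hull:
  fixes A :: "(real \<times> real) set"
  assumes "finite A" and A: "A \<noteq> {}" "\<And>m. m \<in> A \<Longrightarrow> m \<le> M"
    "\<And>m m'. m \<in> A \<Longrightarrow> m' \<in> A \<Longrightarrow> m \<le> m' \<Longrightarrow> m = m'"
  shows "pq_interval (card A) 1 (antichain_hull A M)"
proof -
  have "(\<exists>m\<in>A. m \<le> z) \<and> z \<le> M" if "z \<in> antichain_hull A M" for z
    using that by (auto simp: antichain_hull_def)
  moreover have "0 < card A"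
    using assms(1) A(1) by (simp add: card_gt_0_iff)
  ultimately show ?thesis
    using poset_interval_antichain_hull[OF A]
    by (simp add: pq_interval_def minimal_points_antichain_hull[OF A]
        maximal_points_antichain_hull[OF A])
qed

section \<open>The vectors of single intervals\<close>

lemma exhaust_6:
  fixes k :: 6
  shows "k = 1 \<or> k = 2 \<or> k = 3 \<or> k = 4 \<or> k = 5 \<or> k = 6"
proof (induct k)
  case (of_int z)
  then have "0 \<le> z" "z < 6" by simp_all
  then have "z = 0 \<or> z = 1 \<or> z = 2 \<or> z = 3 \<or> z = 4 \<or> z = 5" by arith
  then show ?case by auto
qed

lemma forall_6: "(\<forall>k::6. P k) \<longleftrightarrow> P 1 \<and> P 2 \<and> P 3 \<and> P 4 \<and> P 5 \<and> P 6"
  by (metis exhaust_6)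

lemma vector_6 [simp]:
  "(vector [x1, x2, x3, x4, x5, x6] :: 'a::zero ^ 6) $ 1 = x1"
  "(vector [x1, x2, x3, x4, x5, x6] :: 'a::zero ^ 6) $ 2 = x2"
  "(vector [x1, x2, x3, x4, x5, x6] :: 'a::zero ^ 6) $ 3 = x3"
  "(vector [x1, x2, x3, x4, x5, x6] :: 'a::zero ^ 6) $ 4 = x4"
  "(vector [x1, x2, x3, x4, x5, x6] :: 'a::zero ^ 6) $ 5 = x5"
  "(vector [x1, x2, x3, x4, x5, x6] :: 'a::zero ^ 6) $ 6 = x6"
  unfolding vector_def by simp_all

definition interval_vectors :: "(real ^ 6) set" where
  "interval_vectors =
     {v. 0 \<le> v $ 3 \<and> 0 \<le> v $ 6 \<and> (v $ 4 = 0 \<and> v $ 5 = 0 \<or> 0 < v $ 4 \<and> 0 < v $ 5)}"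

text \<open>
  The minimal points have to lie below the unique maximal point because every point of the interval
  lies below some maximal point; this gives the two nonnegative coordinates.
\<close>

lemma interval_vec_in_interval_vectors:
  assumes "pq_interval 1 1 I \<or> pq_interval 2 1 I"
  shows "interval_vec I \<in> interval_vectors"
proof -
  have below: "m \<le> M" if "m \<in> minimal_points I" "maximal_points I = {M}" for m M
    using assms that by (auto simp: pq_interval_def minimal_points_def)
  have "represents I (interval_vec I)"
    using assms by (rule represents_interval_vec)
  then show ?thesis
    unfolding represents_def
    by (elim disjE exE conjE) (use below in \<open>force simp: interval_vectors_def\<close>)+
qed

lemma interval_vectors_attained:
  assumes "v \<in> interval_vectors"
  shows "\<exists>I. (pq_interval 1 1 I \<or> pq_interval 2 1 I) \<and> interval_vec I = v"
proof -
  define m1 m2 M where "m1 = (v $ 1 - v $ 4, v $ 2)" and "m2 = (v $ 1, v $ 2 - v $ 5)"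
    and "M = (v $ 1 + v $ 6, v $ 2 + v $ 3)"
  \<comment> \<open>For \<open>b = c = 0\<close> the two points coincide, so that one set \<open>A\<close> serves both cases.\<close>
  define A where "A = {m1, m2}"
  have A: "finite A" "A \<noteq> {}" "\<And>m. m \<in> A \<Longrightarrow> m \<le> M"
    "\<And>m m'. m \<in> A \<Longrightarrow> m' \<in> A \<Longrightarrow> m \<le> m' \<Longrightarrow> m = m'"
    using assms by (auto simp: interval_vectors_def A_def m1_def m2_def M_def)
  have pq: "pq_interval (card A) 1 (antichain_hull A M)"
    using A by (rule pq_interval_antichain_hull)
  have extremal: "minimal_points (antichain_hull A M) = A"
      "maximal_points (antichain_hull A M) = {M}"
    using minimal_points_antichain_hull[OF A(2-4)] maximal_points_antichain_hull[OF A(2-4)]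
    by auto
  consider (one) "v $ 4 = 0" "v $ 5 = 0" | (two) "0 < v $ 4" "0 < v $ 5"
    using assms by (auto simp: interval_vectors_def)
  then show ?thesis
  proof cases
    case one
    then have "A = {(v $ 1, v $ 2)}"
      by (auto simp: A_def m1_def m2_def)
    moreover from this have "represents (antichain_hull A M) v"
      unfolding represents_def extremal
      using one by (intro disjI1) (simp add: M_def vec_eq_iff forall_6)
    ultimately show ?thesis
      using pq interval_vec_eqI by force
  next
    case two
    then have "card A = 2"
      by (simp add: A_def m1_def m2_def)
    moreover have "represents (antichain_hull A M) v"
      unfolding represents_def extremal
    proof (intro disjI2 exI conjI)
      show "A = {(v $ 1 - v $ 4, v $ 2), (v $ 1, v $ 2 - v $ 5)}"
        by (simp add: A_def m1_def m2_def)
      show "{M} = {(v $ 1 + v $ 6, v $ 2 + v $ 3)}"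
        by (simp add: M_def)
    qed (use two in \<open>simp_all add: vec_eq_iff forall_6\<close>)
    ultimately show ?thesis
      using pq interval_vec_eqI by force
  qed
qed

lemma interval_vec_image:
  "interval_vec ` {I. pq_interval 1 1 I \<or> pq_interval 2 1 I} = interval_vectors"
  using interval_vec_in_interval_vectors interval_vectors_attained by blast

section \<open>Convexity\<close>

text \<open>
  A proper convex combination of two vectors has \<open>b = c = 0\<close> if both of them have, and \<open>b, c > 0\<close>
  otherwise, since one positive contribution with positive weight suffices.
\<close>

lemma convex_interval_vectors: "convex interval_vectors"
proof -
  have "u *\<^sub>R v + t *\<^sub>R w \<in> interval_vectors"
    if "v \<in> interval_vectors" "w \<in> interval_vectors" "0 < u" "0 < t" for v w u t
    using that by (auto simp: interval_vectors_def add_pos_pos)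
  then show ?thesis
    by (force simp: convex_def order_le_less)
qed

text \<open>
  The coordinates of distinct blocks do not interact, and the entries of a family can be chosen
  independently of one another, so a vector is attained as soon as each of its blocks is.
\<close>

lemma family_vec_image:
  "family_vec ` (interval_families :: ('n::finite \<Rightarrow> (real \<times> real) set) set)
     = (\<Inter>r. (\<lambda>v. \<chi> k. v $ (r, k)) -` interval_vectors)"
proof (intro equalityI subsetI)
  fix v :: "real ^ ('n \<times> 6)"
  assume "v \<in> family_vec ` (interval_families :: ('n \<Rightarrow> (real \<times> real) set) set)"
  then show "v \<in> (\<Inter>r. (\<lambda>v. \<chi> k. v $ (r, k)) -` interval_vectors)"
    using interval_vec_in_interval_vectors by (auto simp: family_vec_def interval_families_def)
next
  fix v :: "real ^ ('n \<times> 6)"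
  assume "v \<in> (\<Inter>r. (\<lambda>v. \<chi> k. v $ (r, k)) -` interval_vectors)"
  then have "(\<chi> k. v $ (r, k)) \<in> interval_vec ` {I. pq_interval 1 1 I \<or> pq_interval 2 1 I}" for r
    unfolding interval_vec_image by simp
  then have "\<forall>r. \<exists>I. (pq_interval 1 1 I \<or> pq_interval 2 1 I) \<and> interval_vec I = (\<chi> k. v $ (r, k))"
    by (metis (mono_tags, lifting) imageE mem_Collect_eq)
  then obtain \<I> where "\<And>r. pq_interval 1 1 (\<I> r) \<or> pq_interval 2 1 (\<I> r)"
      "\<And>r. interval_vec (\<I> r) = (\<chi> k. v $ (r, k))"
    by metis
  then have "\<I> \<in> interval_families" "family_vec \<I> = v"
    by (auto simp: interval_families_def family_vec_def vec_eq_iff)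
  then show "v \<in> family_vec ` (interval_families :: ('n \<Rightarrow> (real \<times> real) set) set)"
    by blast
qed

theorem proposition13:
  "convex (family_vec ` (interval_families :: ('n::finite \<Rightarrow> (real \<times> real) set) set))"
proof -
  have "linear (\<lambda>v :: real ^ ('n \<times> 6). \<chi> k. v $ (r, k))" for r
    by (rule linearI) (simp_all add: vec_eq_iff)
  then show ?thesis
    unfolding family_vec_image
    by (intro convex_INT convex_linear_vimage convex_interval_vectors)
qed

end
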